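(* Let $\mathcal{A}$ be a distribution over pairs of functions $h,g\colon\{-1,1\}^d\to R$, and define $\hat f\colon[-1,1]\to[0,1]$ by $\hat f(\alpha)=\Pr[h(x)=g(y)]$, where $(h,g)\sim\mathcal{A}$ and $(x,y)$ is randomly $\alpha$-correlated (independently of $(h,g)$). Then for every $\alpha\in(-1,1)$, $$\hat f(0)^{\frac{1+|\alpha|}{1-|\alpha|}}\le\hat f(\alpha)\le\hat f(0)^{\frac{1-|\alpha|}{1+|\alpha|}}.$$
   Context: For $-1\le\alpha\le1$, a pair $(x,y)\in\{-1,1\}^d\times\{-1,1\}^d$ is randomly $\alpha$-correlated if the pairs $(x_i,y_i)$ are i.i.d. with $x_i$ uniform in $\{-1,1\}$ and $y_i=x_i$ with probability $(1+\alpha)/2$, $y_i=-x_i$ with probability $(1-\alpha)/2$. $R$ is a finite set. *)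

theory Defs
  imports "HOL-Probability.Probability"
begin

definition cube :: "nat \<Rightarrow> (nat \<Rightarrow> int) set" where
  "cube d = ({..<d} \<rightarrow>\<^sub>E {-1, 1})"

definition correlated_bit :: "real \<Rightarrow> (int \<times> int) pmf" where
  "correlated_bit \<alpha> =
     do {
       x \<leftarrow> pmf_of_set {-1, 1};
       b \<leftarrow> bernoulli_pmf ((1 + \<alpha>) / 2);
       return_pmf (x, if b then x else - x)
     }"

text \<open>
  The default value \<^term>\<open>(undefined, undefined)\<close> makes both components extensional on
  \<^term>\<open>{..<d}\<close>, so that the distribution lives on \<^term>\<open>cube d \<times> cube d\<close>.
\<close>

definition correlated_pair :: "nat \<Rightarrow> real \<Rightarrow> ((nat \<Rightarrow> int) \<times> (nat \<Rightarrow> int)) pmf" where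
  "correlated_pair d \<alpha> =
     map_pmf (\<lambda>z. (\<lambda>i. fst (z i), \<lambda>i. snd (z i)))
       (Pi_pmf {..<d} (undefined, undefined) (\<lambda>_. correlated_bit \<alpha>))"

lemma set_pmf_correlated_pair: "set_pmf (correlated_pair d \<alpha>) \<subseteq> cube d \<times> cube d"
proof
  fix p assume "p \<in> set_pmf (correlated_pair d \<alpha>)"
  then obtain z where z: "z \<in> PiE_dflt {..<d} (undefined, undefined) (\<lambda>_. set_pmf (correlated_bit \<alpha>))"
    and p: "p = (\<lambda>i. fst (z i), \<lambda>i. snd (z i))"
    by (auto simp: correlated_pair_def set_Pi_pmf)
  have bit: "fst q \<in> {-1, 1} \<and> snd q \<in> {-1, 1}" if "q \<in> set_pmf (correlated_bit \<alpha>)" for q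
    using that by (auto simp: correlated_bit_def split: if_splits)
  have inside: "z i \<in> set_pmf (correlated_bit \<alpha>)" if "i < d" for i
    using z that by (simp add: PiE_dflt_def)
  have outside: "z i = (undefined, undefined)" if "\<not> i < d" for i
    using z that by (simp add: PiE_dflt_def)
  have "(\<lambda>i. fst (z i)) \<in> cube d"
    unfolding cube_def by (rule PiE_I) (use bit inside in blast, simp add: outside)
  moreover have "(\<lambda>i. snd (z i)) \<in> cube d"
    unfolding cube_def by (rule PiE_I) (use bit inside in blast, simp add: outside)
  ultimately show "p \<in> cube d \<times> cube d"
    by (simp add: p)
qed

definition collision_prob ::
  "nat \<Rightarrow> (((nat \<Rightarrow> int) \<Rightarrow> 'r) \<times> ((nat \<Rightarrow> int) \<Rightarrow> 'r)) pmf \<Rightarrow> real \<Rightarrow> real" where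
  "collision_prob d \<A> \<alpha> =
     measure_pmf.prob (pair_pmf \<A> (correlated_pair d \<alpha>)) {((h, g), (x, y)). h x = g y}"

end

theory Submission imports Defs begin

text \<open>
  Two-function hypercontractivity and its reverse say that for nonnegative \<open>f, g\<close> on the cube,
  \<open>E[f(x) g(y)]\<close> is at most the product of the norms with exponent \<open>1 + |\<alpha>|\<close> and at least the
  product of the norms with exponent \<open>1 - |\<alpha>|\<close>.  Both tensorise, so they reduce to one bit, where
  a Cauchy--Schwarz argument reduces them further to the comparison of
  \<open>((1 + s)^p + (1 - s)^p) / 2\<close> with \<open>(1 - \<rho> s^2)^(p/2)\<close> for \<open>p = 1 - \<rho>\<close>, \<open>\<rho> = |\<alpha>|\<close> or
  \<open>\<rho> = -|\<alpha>|\<close>.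

  For fixed \<open>h, g\<close> let \<open>w_r\<close> be the geometric mean of the densities of the fibres of \<open>h\<close> and \<open>g\<close>
  over \<open>r\<close>.  Then the collision probability is \<open>\<Sum> w_r^2\<close> at correlation \<open>0\<close>, and lies between
  \<open>\<Sum> w_r^(2/(1-|\<alpha>|))\<close> and \<open>\<Sum> w_r^(2/(1+|\<alpha>|))\<close> at correlation \<open>\<alpha>\<close>.  Since \<open>\<Sum> w_r \<le> 1\<close>, Jensen's
  inequality with the weights \<open>w_r\<close> and the power \<open>(1 + |\<alpha>|) / (1 - |\<alpha>|)\<close> compares these sums, and a
  second application averages over \<open>(h, g)\<close>.
\<close>


section \<open>The two-point power mean inequality\<close>

text \<open>Twice the inequality \<open>artanh (\<rho> x) \<le> \<rho> artanh x\<close>, which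
  expresses convexity of artanh on [0, 1) with value 0 at 0. Both sides vanish at 0, so comparing
  derivatives suffices.\<close>

lemma ln_ratio_contraction:
  fixes \<rho> x :: real
  assumes "0 \<le> \<rho>" "\<rho> < 1" "0 \<le> x" "x < 1"
  shows "ln (1 + \<rho> * x) - ln (1 - \<rho> * x) \<le> \<rho> * (ln (1 + x) - ln (1 - x))"
proof -
  define F where "F t = \<rho> * (ln (1 + t) - ln (1 - t)) - (ln (1 + \<rho> * t) - ln (1 - \<rho> * t))" for t
  have "F 0 \<le> F x"
  proof (rule DERIV_nonneg_imp_nondecreasing[OF \<open>0 \<le> x\<close>])
    fix t assume t: "0 \<le> t" "t \<le> x"
    have b: "\<rho> * t \<le> t" "0 \<le> \<rho> * t" "t < 1"
      using assms t by (auto simp: mult_left_le_one_le)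
    have "t * t < 1 * 1" "(\<rho> * t) * (\<rho> * t) < 1 * 1"
      using b t by (intro mult_strict_mono'; simp)+
    hence sq: "t * t \<noteq> 1" "(\<rho> * t) * (\<rho> * t) \<noteq> 1" by auto
    have "(F has_real_derivative \<rho> * (1 / (1 + t) + 1 / (1 - t))
        - (\<rho> / (1 + \<rho> * t) + \<rho> / (1 - \<rho> * t))) (at t)"
      unfolding F_def using b t
      by (auto intro!: derivative_eq_intros simp: divide_simps)
    moreover have "1 / (1 + t) + 1 / (1 - t) = 2 / (1 - t\<^sup>2)"
      using b t sq by (auto simp: divide_simps power2_eq_square) (auto simp: algebra_simps)
    moreover have "\<rho> / (1 + \<rho> * t) + \<rho> / (1 - \<rho> * t) = \<rho> * (2 / (1 - (\<rho> * t)\<^sup>2))"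
      using b t sq by (auto simp: divide_simps power2_eq_square) (auto simp: algebra_simps)
    moreover have "2 / (1 - (\<rho> * t)\<^sup>2) \<le> 2 / (1 - t\<^sup>2)"
    proof -
      have "(\<rho> * t)\<^sup>2 \<le> t\<^sup>2" using b by (intro power_mono) auto
      moreover have "t\<^sup>2 < 1" using t b by (simp add: power_less_one_iff)
      ultimately show ?thesis by (intro divide_left_mono) auto
    qed
    ultimately show "\<exists>y. (F has_real_derivative y) (at t) \<and> 0 \<le> y"
      using assms(1) by (metis diff_ge_0_iff_ge mult_left_mono)
  qed
  thus ?thesis by (simp add: F_def)
qed

text \<open>The exponential of \<open>ln_ratio_contraction\<close>; a negative \<open>\<rho>\<close>
  exchanges the factors \<open>1 + \<rho> * x\<close> and \<open>1 - \<rho> * x\<close>, which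
  reverses the inequality.\<close>

lemma powr_ratio_contraction:
  fixes \<rho> x :: real
  assumes "\<bar>\<rho>\<bar> < 1" "0 \<le> x" "x < 1"
  shows "0 \<le> \<rho> \<Longrightarrow> (1 + \<rho> * x) * (1 + x) powr - \<rho> \<le> (1 - \<rho> * x) * (1 - x) powr - \<rho>"
    and "\<rho> \<le> 0 \<Longrightarrow> (1 - \<rho> * x) * (1 - x) powr - \<rho> \<le> (1 + \<rho> * x) * (1 + x) powr - \<rho>"
proof -
  have "\<bar>\<rho> * x\<bar> < 1"
    using assms mult_strict_mono'[of "\<bar>\<rho>\<bar>" 1 x 1] by (simp add: abs_mult)
  hence eq: "(1 + \<rho> * x) * (1 + x) powr - \<rho> = exp (ln (1 + \<rho> * x) - \<rho> * ln (1 + x))"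
    "(1 - \<rho> * x) * (1 - x) powr - \<rho> = exp (ln (1 - \<rho> * x) - \<rho> * ln (1 - x))"
    using assms by (auto simp: powr_def exp_diff exp_minus field_simps)
  show "0 \<le> \<rho> \<Longrightarrow> (1 + \<rho> * x) * (1 + x) powr - \<rho> \<le> (1 - \<rho> * x) * (1 - x) powr - \<rho>"
    unfolding eq exp_le_cancel_iff
    using ln_ratio_contraction[of \<rho> x] assms by (simp add: algebra_simps)
  show "\<rho> \<le> 0 \<Longrightarrow> (1 - \<rho> * x) * (1 - x) powr - \<rho> \<le> (1 + \<rho> * x) * (1 + x) powr - \<rho>"
    unfolding eq exp_le_cancel_iff
    using ln_ratio_contraction[of "- \<rho>" x] assms by (simp add: algebra_simps)
qed

text \<open>One-bit comparison for the values \<open>1 + s\<close> and \<open>1 - s\<close>, of mean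
  1. The logarithm \<open>L\<close> of the quotient of the two sides vanishes at 0 and is
  monotone.\<close>

lemma power_mean_two_point:
  fixes \<rho> s :: real
  assumes \<rho>: "\<bar>\<rho>\<bar> < 1" and s: "0 \<le> s" "s \<le> 1"
  defines "p \<equiv> 1 - \<rho>"
  shows "0 \<le> \<rho> \<Longrightarrow> ((1 + s) powr p + (1 - s) powr p) / 2 \<le> (1 - \<rho> * s\<^sup>2) powr (p / 2)"
    and "\<rho> \<le> 0 \<Longrightarrow> (1 - \<rho> * s\<^sup>2) powr (p / 2) \<le> ((1 + s) powr p + (1 - s) powr p) / 2"
proof -
  have p: "0 < p" using \<rho> by (simp add: p_def)
  \<comment> \<open>The sign of the logarithmic derivative of the quotient of the two sides is that of \<open>N\<close>.\<close>
  define S where "S x = (1 + x) powr p + (1 - x) powr p" for x :: real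
  define L where "L x = ln (S x / 2) - p / 2 * ln (1 - \<rho> * x\<^sup>2)" for x :: real
  define N where "N x = (1 + \<rho> * x) * (1 + x) powr - \<rho> - (1 - \<rho> * x) * (1 - x) powr - \<rho>" for x :: real
  have Spos: "S x > 0" if "0 \<le> x" for x
    using that by (auto simp: S_def intro!: add_pos_nonneg)
  have Qpos: "1 - \<rho> * x\<^sup>2 > 0" if "0 \<le> x" "x \<le> 1" for x
  proof -
    have "\<bar>\<rho>\<bar> * x\<^sup>2 \<le> \<bar>\<rho>\<bar> * 1"
      using that by (intro mult_left_mono) (auto simp: power_le_one)
    thus ?thesis using \<rho> by (smt (verit) mult_right_mono zero_le_power2)
  qed
  have deriv: "(L has_real_derivative p * N x / (S x * (1 - \<rho> * x\<^sup>2))) (at x)"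
    if x: "0 < x" "x < 1" for x
  proof -
    \<comment> \<open>This makes \<open>S\<close> and its derivative combinations of the same two
      powers, so the numerator below collapses to \<open>N x\<close>.\<close>
    have plus: "(1 + x) powr p = (1 + x) * (1 + x) powr - \<rho>"
      and minus: "(1 - x) powr p = (1 - x) * (1 - x) powr - \<rho>"
      using x by (simp_all add: p_def powr_diff powr_minus divide_inverse)
    have S': "(S has_real_derivative p * ((1 + x) powr - \<rho> - (1 - x) powr - \<rho>)) (at x)"
      unfolding S_def using x by (auto intro!: derivative_eq_intros simp: p_def algebra_simps)
    have "(L has_real_derivative p * ((1 + x) powr - \<rho> - (1 - x) powr - \<rho>) / S x
        + p * \<rho> * x / (1 - \<rho> * x\<^sup>2)) (at x)"
      unfolding L_def using x Spos[of x] Qpos[of x]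
      by (auto intro!: derivative_eq_intros S' simp: field_simps)
    also have "p * ((1 + x) powr - \<rho> - (1 - x) powr - \<rho>) / S x + p * \<rho> * x / (1 - \<rho> * x\<^sup>2)
        = p * (((1 + x) powr - \<rho> - (1 - x) powr - \<rho>) * (1 - \<rho> * x\<^sup>2) + \<rho> * x * S x)
           / (S x * (1 - \<rho> * x\<^sup>2))"
      using x Spos[of x] Qpos[of x] by (simp add: field_simps)
    also have "((1 + x) powr - \<rho> - (1 - x) powr - \<rho>) * (1 - \<rho> * x\<^sup>2) + \<rho> * x * S x = N x"
      unfolding N_def S_def plus minus by (simp add: algebra_simps power2_eq_square)
    finally show ?thesis .
  qed
  \<comment> \<open>The derivative is available only for \<open>x < 1\<close>; continuity up to the
    end point covers \<open>s = 1\<close>.\<close>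
  have "continuous_on {0..s} S"
    unfolding S_def using s p by (intro continuous_intros continuous_on_powr') auto
  hence cont: "continuous_on {0..s} L"
    unfolding L_def using s Spos Qpos by (intro continuous_intros) (auto simp: less_imp_neq[symmetric])
  have L0: "L 0 = 0" by (simp add: L_def S_def)
  have S_eq: "((1 + s) powr p + (1 - s) powr p) / 2 = exp (ln (S s / 2))"
    using Spos[of s] s by (simp add: S_def)
  have Q_eq: "(1 - \<rho> * s\<^sup>2) powr (p / 2) = exp (p / 2 * ln (1 - \<rho> * s\<^sup>2))"
    using Qpos[of s] s by (simp add: powr_def)
  show "((1 + s) powr p + (1 - s) powr p) / 2 \<le> (1 - \<rho> * s\<^sup>2) powr (p / 2)" if "0 \<le> \<rho>"
  proof -
    have "p * N x / (S x * (1 - \<rho> * x\<^sup>2)) \<le> 0" if "0 < x" "x < s" for x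
      using powr_ratio_contraction(1)[OF \<rho>, of x] \<open>0 \<le> \<rho>\<close> that s p Spos[of x] Qpos[of x]
      by (intro divide_nonpos_nonneg mult_nonneg_nonpos) (auto simp: N_def)
    hence "L s \<le> L 0"
      using deriv s by (intro DERIV_nonpos_imp_decreasing_open[OF s(1) _ cont])
        (meson less_le_trans)
    thus ?thesis unfolding S_eq Q_eq by (simp add: L0) (simp add: L_def)
  qed
  show "(1 - \<rho> * s\<^sup>2) powr (p / 2) \<le> ((1 + s) powr p + (1 - s) powr p) / 2" if "\<rho> \<le> 0"
  proof -
    have "p * N x / (S x * (1 - \<rho> * x\<^sup>2)) \<ge> 0" if "0 < x" "x < s" for x
      using powr_ratio_contraction(2)[OF \<rho>, of x] \<open>\<rho> \<le> 0\<close> that s p Spos[of x] Qpos[of x]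
      by (intro divide_nonneg_nonneg mult_nonneg_nonneg) (auto simp: N_def)
    hence "L s \<ge> L 0"
      using deriv s by (intro DERIV_nonneg_imp_increasing_open[OF s(1) _ cont])
        (meson less_le_trans)
    thus ?thesis unfolding S_eq Q_eq by (simp add: L0) (simp add: L_def)
  qed
qed

section \<open>Hypercontractivity for one bit\<close>

definition bit_norm :: "real \<Rightarrow> real \<Rightarrow> real \<Rightarrow> real" where
  "bit_norm p u v = ((u powr p + v powr p) / 2) powr (1 / p)"

text \<open>\<open>Q\<close> is quadratic in the mean and the half-difference, which prepares for
  Cauchy-Schwarz. Both sides are homogeneous, so dividing by the mean leaves
  \<open>power_mean_two_point\<close> under a \<open>p\<close>-th root.\<close>

lemma bit_norm_bound:
  fixes \<rho> u v :: real
  assumes \<rho>: "\<bar>\<rho>\<bar> < 1" and uv: "0 \<le> u" "0 \<le> v"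
  defines "Q \<equiv> ((u + v) / 2)\<^sup>2 - \<rho> * ((u - v) / 2)\<^sup>2"
  shows "0 \<le> \<rho> \<Longrightarrow> bit_norm (1 - \<rho>) u v \<le> sqrt Q"
    and "\<rho> \<le> 0 \<Longrightarrow> sqrt Q \<le> bit_norm (1 - \<rho>) u v"
    and "0 \<le> Q"
proof -
  define p where "p = 1 - \<rho>"
  have p: "0 < p" using \<rho> by (simp add: p_def)
  define m where "m = (u + v) / 2"
  have m: "0 \<le> m" using uv by (simp add: m_def)
  \<comment> \<open>For \<open>m > 0\<close> the witness is |u - v| / (u + v), at most 1 by
    nonnegativity; for \<open>m = 0\<close> both values vanish and 0 serves.\<close>
  obtain s where s: "0 \<le> s" "s \<le> 1" and ms: "m * s = \<bar>u - v\<bar> / 2"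
  proof (cases "m = 0")
    case True
    with uv have "u = 0" "v = 0" by (auto simp: m_def)
    with that[of 0] True show ?thesis by simp
  next
    case False
    with that[of "\<bar>u - v\<bar> / 2 / m"] uv m show ?thesis by (auto simp: m_def divide_simps)
  qed
  have sym: "u powr p + v powr p = (m * (1 + s)) powr p + (m * (1 - s)) powr p"
  proof (cases "u \<ge> v")
    case True
    hence "m * (1 + s) = u" "m * (1 - s) = v" using ms by (auto simp: algebra_simps m_def field_simps)
    thus ?thesis by simp
  next
    case False
    hence "m * (1 + s) = v" "m * (1 - s) = u" using ms by (auto simp: algebra_simps m_def field_simps)
    thus ?thesis by simp
  qed
  have "(u powr p + v powr p) / 2 = m powr p * (((1 + s) powr p + (1 - s) powr p) / 2)"
    unfolding sym powr_mult by (simp only: distrib_left times_divide_eq_right)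
  hence norm: "bit_norm p u v = m * (((1 + s) powr p + (1 - s) powr p) / 2) powr (1 / p)"
    unfolding bit_norm_def using m p by (simp only: powr_mult) (simp add: powr_powr)
  have "\<bar>\<rho>\<bar> * s\<^sup>2 \<le> \<bar>\<rho>\<bar> * 1"
    using s by (intro mult_left_mono) (auto simp: power_le_one)
  hence q: "0 \<le> 1 - \<rho> * s\<^sup>2" using \<rho> by (smt (verit) mult_right_mono zero_le_power2)
  have "((u - v) / 2)\<^sup>2 = (m * s)\<^sup>2" by (simp add: ms power_divide)
  hence Q: "Q = m\<^sup>2 * (1 - \<rho> * s\<^sup>2)"
    by (simp add: Q_def m_def[symmetric] algebra_simps power_mult_distrib)
  show "0 \<le> Q" unfolding Q using q by simp
  have sqrtQ: "sqrt Q = m * ((1 - \<rho> * s\<^sup>2) powr (p / 2)) powr (1 / p)"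
    using m q p by (simp add: Q real_sqrt_mult powr_powr powr_half_sqrt)
  show "0 \<le> \<rho> \<Longrightarrow> bit_norm (1 - \<rho>) u v \<le> sqrt Q"
    unfolding p_def[symmetric] norm sqrtQ
    using power_mean_two_point(1)[OF \<rho> s] m p s
    by (intro mult_left_mono powr_mono2) (auto simp: p_def)
  show "\<rho> \<le> 0 \<Longrightarrow> sqrt Q \<le> bit_norm (1 - \<rho>) u v"
    unfolding p_def[symmetric] norm sqrtQ
    using power_mean_two_point(2)[OF \<rho> s] m p s
    by (intro mult_left_mono powr_mono2) (auto simp: p_def)
qed

lemma bit_norm_nonneg: "0 \<le> bit_norm p u v"
  by (simp add: bit_norm_def)

text \<open>The expectation of \<open>f x * g y\<close> over an \<alpha>-correlated pair of bits,
  written out over its four outcomes.\<close>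

definition bit_form :: "real \<Rightarrow> (int \<Rightarrow> real) \<Rightarrow> (int \<Rightarrow> real) \<Rightarrow> real" where
  "bit_form \<alpha> f g = (1 + \<alpha>) / 4 * (f 1 * g 1 + f (-1) * g (-1))
     + (1 - \<alpha>) / 4 * (f 1 * g (-1) + f (-1) * g 1)"

text \<open>In means and half-differences the form is \<open>m * n + \<alpha> * (a * b)\<close>.
  Cauchy-Schwarz and its reverse for the indefinite form
  \<open>m\<^sup>2 - \<bar>\<alpha>\<bar> * a\<^sup>2\<close> reduce both bounds to
  \<open>bit_norm_bound\<close>.\<close>

lemma bit_form_hypercontractive:
  fixes f g :: "int \<Rightarrow> real"
  assumes \<alpha>: "\<bar>\<alpha>\<bar> < 1" and f: "0 \<le> f 1" "0 \<le> f (-1)" and g: "0 \<le> g 1" "0 \<le> g (-1)"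
  shows "bit_norm (1 - \<bar>\<alpha>\<bar>) (f 1) (f (-1)) * bit_norm (1 - \<bar>\<alpha>\<bar>) (g 1) (g (-1)) \<le> bit_form \<alpha> f g"
    and "bit_form \<alpha> f g \<le> bit_norm (1 + \<bar>\<alpha>\<bar>) (f 1) (f (-1)) * bit_norm (1 + \<bar>\<alpha>\<bar>) (g 1) (g (-1))"
proof -
  define m n where "m = (f 1 + f (-1)) / 2" and "n = (g 1 + g (-1)) / 2"
  define a b where "a = (f 1 - f (-1)) / 2" and "b = (g 1 - g (-1)) / 2"
  have form: "bit_form \<alpha> f g = m * n + \<alpha> * (a * b)"
    by (simp add: bit_form_def m_def n_def a_def b_def field_simps)
  have mn: "0 \<le> m" "0 \<le> n" using f g by (auto simp: m_def n_def)
  have "\<bar>a\<bar> \<le> m" "\<bar>b\<bar> \<le> n" using f g by (auto simp: m_def n_def a_def b_def)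
  hence ab: "\<bar>a * b\<bar> \<le> m * n" unfolding abs_mult using mn by (intro mult_mono) auto
  have "\<bar>\<alpha>\<bar> * \<bar>a * b\<bar> \<le> 1 * \<bar>a * b\<bar>" using \<alpha> by (intro mult_right_mono) auto
  with ab have nonneg: "0 \<le> m * n - \<bar>\<alpha>\<bar> * \<bar>a * b\<bar>" by simp
  have dev: "\<bar>\<alpha> * (a * b)\<bar> = \<bar>\<alpha>\<bar> * \<bar>a * b\<bar>" by (simp add: abs_mult)
  \<comment> \<open>A Lagrange identity: \<open>\<rho> = \<bar>\<alpha>\<bar>\<close> gives the
    reverse Cauchy-Schwarz inequality, \<open>\<rho> = -\<bar>\<alpha>\<bar>\<close> the usual
    one.\<close>
  have cs: "(m * n - \<rho> * \<bar>a * b\<bar>)\<^sup>2 - (m\<^sup>2 - \<rho> * a\<^sup>2) * (n\<^sup>2 - \<rho> * b\<^sup>2)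
      = \<rho> * (m * \<bar>b\<bar> - n * \<bar>a\<bar>)\<^sup>2" for \<rho>
    unfolding abs_mult power2_diff power_mult_distrib power2_abs
    by (simp add: algebra_simps) (simp add: power2_eq_square algebra_simps)
  note fb = bit_norm_bound[OF _ f, folded m_def a_def]
    and gb = bit_norm_bound[OF _ g, folded n_def b_def]
  have "bit_norm (1 - \<bar>\<alpha>\<bar>) (f 1) (f (-1)) * bit_norm (1 - \<bar>\<alpha>\<bar>) (g 1) (g (-1))
      \<le> sqrt (m\<^sup>2 - \<bar>\<alpha>\<bar> * a\<^sup>2) * sqrt (n\<^sup>2 - \<bar>\<alpha>\<bar> * b\<^sup>2)"
    using fb(1)[of "\<bar>\<alpha>\<bar>"] fb(3)[of "\<bar>\<alpha>\<bar>"] gb(1)[of "\<bar>\<alpha>\<bar>"] \<alpha>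
    by (intro mult_mono) (auto simp: bit_norm_nonneg)
  also have "\<dots> \<le> m * n - \<bar>\<alpha>\<bar> * \<bar>a * b\<bar>"
    unfolding real_sqrt_mult[symmetric] using cs[of "\<bar>\<alpha>\<bar>"] nonneg
    by (intro real_le_lsqrt) (auto simp: algebra_simps)
  also have "\<dots> \<le> bit_form \<alpha> f g" unfolding form using dev by linarith
  finally show "bit_norm (1 - \<bar>\<alpha>\<bar>) (f 1) (f (-1)) * bit_norm (1 - \<bar>\<alpha>\<bar>) (g 1) (g (-1))
      \<le> bit_form \<alpha> f g" .
  have "bit_form \<alpha> f g \<le> m * n + \<bar>\<alpha>\<bar> * \<bar>a * b\<bar>" unfolding form using dev by linarith
  also have "\<dots> \<le> sqrt (m\<^sup>2 + \<bar>\<alpha>\<bar> * a\<^sup>2) * sqrt (n\<^sup>2 + \<bar>\<alpha>\<bar> * b\<^sup>2)"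
  proof -
    have "0 \<le> \<bar>\<alpha>\<bar> * (m * \<bar>b\<bar> - n * \<bar>a\<bar>)\<^sup>2" by simp
    thus ?thesis
      using cs[of "-\<bar>\<alpha>\<bar>"]
      unfolding mult_minus_left diff_minus_eq_add real_sqrt_mult[symmetric]
      by (intro real_le_rsqrt) linarith
  qed
  also have "\<dots> \<le> bit_norm (1 + \<bar>\<alpha>\<bar>) (f 1) (f (-1)) * bit_norm (1 + \<bar>\<alpha>\<bar>) (g 1) (g (-1))"
    using fb(2)[of "-\<bar>\<alpha>\<bar>"] gb(2)[of "-\<bar>\<alpha>\<bar>"] gb(3)[of "-\<bar>\<alpha>\<bar>"] \<alpha>
    by (intro mult_mono) (auto simp: bit_norm_nonneg)
  finally show "bit_form \<alpha> f g
      \<le> bit_norm (1 + \<bar>\<alpha>\<bar>) (f 1) (f (-1)) * bit_norm (1 + \<bar>\<alpha>\<bar>) (g 1) (g (-1))" .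
qed

section \<open>Expectations on the cube, one coordinate at a time\<close>

definition uniform_cube :: "nat \<Rightarrow> (nat \<Rightarrow> int) pmf" where
  "uniform_cube d = Pi_pmf {..<d} undefined (\<lambda>_. pmf_of_set {-1, 1})"

lemma expectation_bind_pmf_finite:
  fixes F :: "'b \<Rightarrow> real"
  assumes "finite (set_pmf p)" "\<And>a. a \<in> set_pmf p \<Longrightarrow> finite (set_pmf (f a))"
  shows "measure_pmf.expectation (p \<bind> f) F
    = measure_pmf.expectation p (\<lambda>a. measure_pmf.expectation (f a) F)"
  using assms
  by (subst pmf_expectation_bind[of "set_pmf p"], simp_all)
     (subst integral_measure_pmf[of "set_pmf p"], simp_all)

lemma set_pmf_uniform_cube: "set_pmf (uniform_cube d) = cube d"
  by (auto simp: uniform_cube_def set_Pi_pmf PiE_dflt_def cube_def PiE_iff extensional_def)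

lemma finite_cube: "finite (cube d)"
  by (simp add: cube_def finite_PiE)

lemma finite_set_pmf_correlated_pair: "finite (set_pmf (correlated_pair d \<alpha>))"
  by (rule finite_subset[OF set_pmf_correlated_pair]) (simp add: finite_cube)

lemma finite_set_pmf_correlated_bit: "finite (set_pmf (correlated_bit \<alpha>))"
  by (rule finite_subset[of _ "{-1, 1} \<times> {-1, 1}"]) (auto simp: correlated_bit_def split: if_splits)

lemma expectation_correlated_bit:
  fixes F :: "int \<times> int \<Rightarrow> real"
  assumes "\<bar>\<alpha>\<bar> < 1"
  shows "measure_pmf.expectation (correlated_bit \<alpha>) F
    = (1 + \<alpha>) / 4 * (F (1, 1) + F (-1, -1)) + (1 - \<alpha>) / 4 * (F (1, -1) + F (-1, 1))"
  using assms unfolding correlated_bit_def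
  by (simp add: expectation_bind_pmf_finite integral_pmf_of_set field_simps)

lemma expectation_uniform_cube_Suc:
  fixes F :: "(nat \<Rightarrow> int) \<Rightarrow> real"
  shows "measure_pmf.expectation (uniform_cube (Suc d)) F
    = (measure_pmf.expectation (uniform_cube d) (\<lambda>x. F (x(d := 1)))
     + measure_pmf.expectation (uniform_cube d) (\<lambda>x. F (x(d := -1)))) / 2"
proof -
  have "uniform_cube (Suc d)
      = pmf_of_set {-1, 1} \<bind> (\<lambda>a. map_pmf (\<lambda>x. x(d := a)) (uniform_cube d))"
    by (simp add: uniform_cube_def lessThan_Suc Pi_pmf_insert' map_pmf_def)
  thus ?thesis
    by (simp add: expectation_bind_pmf_finite set_pmf_uniform_cube finite_cube integral_pmf_of_set)
qed

lemma expectation_correlated_pair_Suc: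
  fixes F :: "(nat \<Rightarrow> int) \<times> (nat \<Rightarrow> int) \<Rightarrow> real"
  shows "measure_pmf.expectation (correlated_pair (Suc d) \<alpha>) F
    = measure_pmf.expectation (correlated_bit \<alpha>) (\<lambda>(a, b).
        measure_pmf.expectation (correlated_pair d \<alpha>) (\<lambda>(x, y). F (x(d := a), y(d := b))))"
proof -
  \<comment> \<open>Splitting off coordinate \<open>d\<close> updates a sequence of pairs; this
    turns it into updates of the two component sequences.\<close>
  have upd: "(\<lambda>i. fst ((z(d := c)) i)) = (\<lambda>i. fst (z i))(d := fst c)"
    "(\<lambda>i. snd ((z(d := c)) i)) = (\<lambda>i. snd (z i))(d := snd c)"
    for z :: "nat \<Rightarrow> int \<times> int" and c by auto
  have "correlated_pair (Suc d) \<alpha>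
      = correlated_bit \<alpha> \<bind> (\<lambda>c. map_pmf (\<lambda>(x, y). (x(d := fst c), y(d := snd c))) (correlated_pair d \<alpha>))"
    unfolding correlated_pair_def lessThan_Suc
    by (simp add: Pi_pmf_insert' map_bind_pmf pmf.map_comp o_def upd del: fun_upd_apply)
       (simp add: map_pmf_def del: fun_upd_apply)
  thus ?thesis
    by (simp add: expectation_bind_pmf_finite finite_set_pmf_correlated_pair
        finite_set_pmf_correlated_bit case_prod_unfold)
qed

section \<open>Tensorisation to the cube\<close>

definition cube_form :: "nat \<Rightarrow> real \<Rightarrow> ((nat \<Rightarrow> int) \<Rightarrow> real) \<Rightarrow> ((nat \<Rightarrow> int) \<Rightarrow> real) \<Rightarrow> real" where
  "cube_form d \<alpha> f g = measure_pmf.expectation (correlated_pair d \<alpha>) (\<lambda>(x, y). f x * g y)"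

definition cube_norm :: "nat \<Rightarrow> real \<Rightarrow> ((nat \<Rightarrow> int) \<Rightarrow> real) \<Rightarrow> real" where
  "cube_norm d p f = measure_pmf.expectation (uniform_cube d) (\<lambda>x. f x powr p) powr (1 / p)"

text \<open>Without coordinates, only the default value of the product distribution remains.\<close>

lemma cube_form_0: "cube_form 0 \<alpha> f g = f (\<lambda>_. undefined) * g (\<lambda>_. undefined)"
  by (simp add: cube_form_def correlated_pair_def)

lemma cube_form_Suc:
  assumes "\<bar>\<alpha>\<bar> < 1"
  shows "cube_form (Suc d) \<alpha> f g =
      (1 + \<alpha>) / 4 * (cube_form d \<alpha> (\<lambda>x. f (x(d := 1))) (\<lambda>y. g (y(d := 1)))
        + cube_form d \<alpha> (\<lambda>x. f (x(d := -1))) (\<lambda>y. g (y(d := -1))))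
    + (1 - \<alpha>) / 4 * (cube_form d \<alpha> (\<lambda>x. f (x(d := 1))) (\<lambda>y. g (y(d := -1)))
        + cube_form d \<alpha> (\<lambda>x. f (x(d := -1))) (\<lambda>y. g (y(d := 1))))"
  unfolding cube_form_def expectation_correlated_pair_Suc expectation_correlated_bit[OF assms]
  by simp

lemma cube_form_uncorrelated:
  "cube_form d 0 f g
    = measure_pmf.expectation (uniform_cube d) f * measure_pmf.expectation (uniform_cube d) g"
proof (induction d arbitrary: f g)
  case 0
  show ?case by (simp add: cube_form_0 uniform_cube_def)
next
  case (Suc d)
  show ?case by (simp add: cube_form_Suc Suc.IH expectation_uniform_cube_Suc field_simps)
qed

lemma cube_norm_nonneg: "0 \<le> cube_norm d p f"
  by (simp add: cube_norm_def)

lemma cube_norm_0: "0 < p \<Longrightarrow> 0 \<le> f (\<lambda>_. undefined) \<Longrightarrow> cube_norm 0 p f = f (\<lambda>_. undefined)"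
  by (simp add: cube_norm_def uniform_cube_def powr_powr)

text \<open>The outer power \<open>p\<close> cancels the inner root, so norms with one common
  exponent nest.\<close>

lemma cube_norm_Suc:
  assumes "0 < p"
  shows "cube_norm (Suc d) p f
    = bit_norm p (cube_norm d p (\<lambda>x. f (x(d := 1)))) (cube_norm d p (\<lambda>x. f (x(d := -1))))"
  using assms
  by (simp add: cube_norm_def bit_norm_def expectation_uniform_cube_Suc powr_powr)

text \<open>Condition on the last coordinate: the induction hypothesis bounds the four conditional
  forms by products of conditional norms, and the one-bit inequality applies to these norms as
  functions of that bit.\<close>

lemma cube_form_hypercontractive:
  assumes \<alpha>: "\<bar>\<alpha>\<bar> < 1" and f: "\<And>x. 0 \<le> f x" and g: "\<And>x. 0 \<le> g x"
  shows "cube_norm d (1 - \<bar>\<alpha>\<bar>) f * cube_norm d (1 - \<bar>\<alpha>\<bar>) g \<le> cube_form d \<alpha> f g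
    \<and> cube_form d \<alpha> f g \<le> cube_norm d (1 + \<bar>\<alpha>\<bar>) f * cube_norm d (1 + \<bar>\<alpha>\<bar>) g"
  using f g
proof (induction d arbitrary: f g)
  case 0
  then show ?case using \<alpha> by (simp add: cube_norm_0 cube_form_0)
next
  case (Suc d)
  \<comment> \<open>\<open>s = -1\<close> serves the lower bound and \<open>s = 1\<close> the upper
    one.\<close>
  define N where "N s h a = cube_norm d (1 + s * \<bar>\<alpha>\<bar>) (\<lambda>x. h (x(d := a)))"
    for s and h :: "(nat \<Rightarrow> int) \<Rightarrow> real" and a :: int
  define C where "C a b = cube_form d \<alpha> (\<lambda>x. f (x(d := a))) (\<lambda>y. g (y(d := b)))" for a b
  have lower: "N (-1) f a * N (-1) g b \<le> C a b" and upper: "C a b \<le> N 1 f a * N 1 g b" for a b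
    using Suc.IH[of "\<lambda>x. f (x(d := a))" "\<lambda>x. g (x(d := b))"] Suc.prems
    by (auto simp: N_def C_def)
  have form: "cube_form (Suc d) \<alpha> f g
      = (1 + \<alpha>) / 4 * (C 1 1 + C (-1) (-1)) + (1 - \<alpha>) / 4 * (C 1 (-1) + C (-1) 1)"
    by (simp add: cube_form_Suc[OF \<alpha>] C_def)
  have norm: "cube_norm (Suc d) (1 - \<bar>\<alpha>\<bar>) h = bit_norm (1 - \<bar>\<alpha>\<bar>) (N (-1) h 1) (N (-1) h (-1))"
    "cube_norm (Suc d) (1 + \<bar>\<alpha>\<bar>) h = bit_norm (1 + \<bar>\<alpha>\<bar>) (N 1 h 1) (N 1 h (-1))" for h
    using \<alpha> by (simp_all add: cube_norm_Suc N_def)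
  have nonneg: "0 \<le> N s h a" for s h a by (simp add: N_def cube_norm_nonneg)
  have "bit_form \<alpha> (N (-1) f) (N (-1) g) \<le> cube_form (Suc d) \<alpha> f g"
    unfolding form bit_form_def using \<alpha> by (intro add_mono mult_left_mono lower) auto
  moreover have "cube_form (Suc d) \<alpha> f g \<le> bit_form \<alpha> (N 1 f) (N 1 g)"
    unfolding form bit_form_def using \<alpha> by (intro add_mono mult_left_mono upper) auto
  ultimately show ?case
    unfolding norm
    using bit_form_hypercontractive[OF \<alpha> nonneg nonneg nonneg nonneg] order.trans by meson
qed

section \<open>Jensen's inequality for powers\<close>

text \<open>Total weight below 1 is harmless: the missing mass can sit at the value 0, whose power
  is 0. The proof sums tangent-line bounds at the mean \<open>m\<close>.\<close>

lemma powr_Jensen_subprob: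
  fixes w y :: "'a \<Rightarrow> real"
  assumes "finite S" "\<And>i. i \<in> S \<Longrightarrow> 0 \<le> w i" "\<And>i. i \<in> S \<Longrightarrow> 0 \<le> y i"
    and "sum w S \<le> 1" and k: "1 \<le> k"
  shows "(\<Sum>i\<in>S. w i * y i) powr k \<le> (\<Sum>i\<in>S. w i * y i powr k)"
proof -
  define m where "m = (\<Sum>i\<in>S. w i * y i)"
  have "0 \<le> m" using assms by (auto simp: m_def intro!: sum_nonneg)
  show ?thesis
  proof (cases "m = 0")
    case True
    thus ?thesis using assms by (auto simp: m_def[symmetric] intro!: sum_nonneg)
  next
    case False
    with \<open>0 \<le> m\<close> have m: "0 < m" by simp
    \<comment> \<open>Young's inequality for \<open>t\<close> and 1 with exponents \<open>k\<close>
      and \<open>k / (k - 1)\<close>; the conjugate exponent forces the case split at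
      \<open>k = 1\<close>.\<close>
    have bernoulli: "1 + k * (t - 1) \<le> t powr k" if "0 \<le> t" for t :: real
    proof (cases "k = 1")
      case False
      with k have "t * 1 \<le> t powr k / k + 1 powr (k / (k - 1)) / (k / (k - 1))"
        using that by (intro Youngs_inequality) (auto simp: field_simps)
      hence "k * t \<le> k * (t powr k / k + (k - 1) / k)" using k by (intro mult_left_mono) auto
      also have "\<dots> = t powr k + (k - 1)" using k by (simp only: distrib_left) simp
      finally show ?thesis by (simp add: algebra_simps)
    qed (use that in simp)
    have tangent: "m powr k * (1 + k * (y i / m - 1)) \<le> y i powr k" if "i \<in> S" for i
    proof -
      have "m powr k * (1 + k * (y i / m - 1)) \<le> m powr k * (y i / m) powr k"
        using assms that m by (intro mult_left_mono bernoulli) auto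
      also have "\<dots> = y i powr k" using assms that m by (simp add: powr_divide)
      finally show ?thesis .
    qed
    \<comment> \<open>The weighted tangent values add up to the right-hand side;
      \<open>sum w S \<le> 1\<close> makes its bracket at least 1.\<close>
    have "m powr k * 1 \<le> m powr k * (k - (k - 1) * sum w S)"
      using mult_left_mono[OF assms(4), of "k - 1"] k by (intro mult_left_mono) auto
    also have "k - (k - 1) * sum w S = (\<Sum>i\<in>S. (1 - k) * w i + k / m * (w i * y i))"
      unfolding sum.distrib sum_distrib_left[symmetric] m_def[symmetric]
      using m by (simp add: algebra_simps)
    also have "m powr k * \<dots> = (\<Sum>i\<in>S. w i * (m powr k * (1 + k * (y i / m - 1))))"
      unfolding sum_distrib_left using m by (intro sum.cong) (auto simp: field_simps)
    also have "\<dots> \<le> (\<Sum>i\<in>S. w i * y i powr k)"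
      using assms by (intro sum_mono mult_left_mono tangent) auto
    finally show ?thesis by (simp add: m_def)
  qed
qed

section \<open>Collisions of a fixed pair of functions\<close>

lemma cube_norm_indicator:
  assumes "0 < p"
  shows "cube_norm d p (\<lambda>x. of_bool (P x))
    = measure_pmf.expectation (uniform_cube d) (\<lambda>x. of_bool (P x)) powr (1 / p)"
proof -
  have "(\<lambda>x. of_bool (P x) powr p) = (\<lambda>x. of_bool (P x) :: real)" by auto
  thus ?thesis by (simp add: cube_norm_def)
qed

text \<open>A collision at \<open>(x, y)\<close> occurs at exactly one value,
  \<open>r = h x\<close>, which lies in \<open>R\<close>.\<close>

lemma prob_eq_sum_cube_form:
  assumes "finite R" "h \<in> cube d \<rightarrow> R"
  shows "measure_pmf.prob (correlated_pair d \<alpha>) {(x, y). h x = g y}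
    = (\<Sum>r\<in>R. cube_form d \<alpha> (\<lambda>x. of_bool (h x = r)) (\<lambda>y. of_bool (g y = r)))"
proof -
  have "measure_pmf.prob (correlated_pair d \<alpha>) {(x, y). h x = g y}
    = measure_pmf.expectation (correlated_pair d \<alpha>) (indicator {(x, y). h x = g y})"
    by simp
  also have "\<dots> = measure_pmf.expectation (correlated_pair d \<alpha>)
      (\<lambda>z. \<Sum>r\<in>R. case z of (x, y) \<Rightarrow> of_bool (h x = r) * of_bool (g y = r))"
  \<comment> \<open>The integrands are compared on the support only, since \<open>h\<close> is known
    to map into \<open>R\<close> only on the cube.\<close>
  proof (rule integral_cong_AE, simp, simp, unfold AE_measure_pmf_iff, rule ballI)
    fix z assume "z \<in> set_pmf (correlated_pair d \<alpha>)"
    with set_pmf_correlated_pair[of d \<alpha>] have "h (fst z) \<in> R"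
      using assms(2) by (metis Pi_mem SigmaE fst_conv subsetD)
    hence "(\<Sum>r\<in>R. of_bool (h (fst z) = r) * of_bool (g (snd z) = r) :: real)
        = (\<Sum>r\<in>R. if h (fst z) = r then of_bool (h (fst z) = g (snd z)) else 0)"
      by (intro sum.cong) auto
    also have "\<dots> = of_bool (h (fst z) = g (snd z))" using \<open>h (fst z) \<in> R\<close> assms(1) by simp
    finally show "indicator {(x, y). h x = g y} z
        = (\<Sum>r\<in>R. (case z of (x, y) \<Rightarrow> of_bool (h x = r) * of_bool (g y = r)) :: real)"
      by (simp add: case_prod_beta indicator_def)
  qed
  also have "\<dots> = (\<Sum>r\<in>R. cube_form d \<alpha> (\<lambda>x. of_bool (h x = r)) (\<lambda>y. of_bool (g y = r)))"
    unfolding cube_form_def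
    by (intro Bochner_Integration.integral_sum integrable_measure_pmf_finite
        finite_set_pmf_correlated_pair)
  finally show ?thesis .
qed

lemma sum_expectation_fibres:
  assumes "finite R" "h \<in> cube d \<rightarrow> R"
  shows "(\<Sum>r\<in>R. measure_pmf.expectation (uniform_cube d) (\<lambda>x. of_bool (h x = r))) = (1::real)"
proof -
  have "(\<Sum>r\<in>R. measure_pmf.expectation (uniform_cube d) (\<lambda>x. of_bool (h x = r)))
      = measure_pmf.expectation (uniform_cube d) (\<lambda>x. \<Sum>r\<in>R. of_bool (h x = r) :: real)"
    by (intro Bochner_Integration.integral_sum[symmetric] integrable_measure_pmf_finite)
       (simp add: set_pmf_uniform_cube finite_cube)
  also have "\<dots> = measure_pmf.expectation (uniform_cube d) (\<lambda>_. 1)"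
    using assms
    by (intro integral_cong_AE) (auto simp: AE_measure_pmf_iff set_pmf_uniform_cube of_bool_def)
  finally show ?thesis by simp
qed

text \<open>The upper bound is stated with the power \<open>k\<close> on the left, so that both
  bounds involve a convex power and can be averaged over pairs by the same Jensen argument.\<close>

lemma collision_fixed_pair:
  fixes h g :: "(nat \<Rightarrow> int) \<Rightarrow> 'r"
  assumes R: "finite R" "h \<in> cube d \<rightarrow> R" "g \<in> cube d \<rightarrow> R" and \<alpha>: "\<bar>\<alpha>\<bar> < 1"
  defines "\<phi> \<equiv> \<lambda>\<beta>. measure_pmf.prob (correlated_pair d \<beta>) {(x, y). h x = g y}"
    and "k \<equiv> (1 + \<bar>\<alpha>\<bar>) / (1 - \<bar>\<alpha>\<bar>)"
  shows "\<phi> 0 powr k \<le> \<phi> \<alpha>" and "\<phi> \<alpha> powr k \<le> \<phi> 0"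
proof -
  define a where "a r = measure_pmf.expectation (uniform_cube d) (\<lambda>x. of_bool (h x = r) :: real)" for r
  define b where "b r = measure_pmf.expectation (uniform_cube d) (\<lambda>x. of_bool (g x = r) :: real)" for r
  define w where "w r = sqrt (a r * b r)" for r
  have ab: "0 \<le> a r" "0 \<le> b r" for r by (simp_all add: a_def b_def)
  have w: "0 \<le> w r" for r using ab by (simp add: w_def)
  have k: "1 \<le> k" using \<alpha> by (simp add: k_def)
  \<comment> \<open>By the arithmetic-geometric mean inequality; the fibre densities of each
    function sum to 1.\<close>
  have "sum w R \<le> (\<Sum>r\<in>R. (a r + b r) / 2)"
    unfolding w_def using ab by (intro sum_mono arith_geo_mean_sqrt)
  also have "\<dots> = 1"
    using sum_expectation_fibres[OF R(1,2)] sum_expectation_fibres[OF R(1,3)]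
    by (simp add: sum_divide_distrib[symmetric] sum.distrib a_def b_def)
  finally have sum_w: "sum w R \<le> 1" .
  have norms: "cube_norm d p (\<lambda>x. of_bool (h x = r)) * cube_norm d p (\<lambda>y. of_bool (g y = r))
      = w r powr (2 / p)" if "0 < p" for p r
    using that ab w
    by (simp add: cube_norm_indicator a_def[symmetric] b_def[symmetric] w_def powr_half_sqrt[symmetric]
        powr_powr powr_mult)
  have \<phi>0: "\<phi> 0 = (\<Sum>r\<in>R. w r * w r)"
    unfolding \<phi>_def prob_eq_sum_cube_form[OF R(1,2)] cube_form_uncorrelated
    using ab by (simp add: w_def a_def b_def)
  have hyper: "w r powr (2 / (1 - \<bar>\<alpha>\<bar>))
        \<le> cube_form d \<alpha> (\<lambda>x. of_bool (h x = r)) (\<lambda>y. of_bool (g y = r))"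
    "cube_form d \<alpha> (\<lambda>x. of_bool (h x = r)) (\<lambda>y. of_bool (g y = r))
        \<le> w r powr (2 / (1 + \<bar>\<alpha>\<bar>))" for r
    using cube_form_hypercontractive[OF \<alpha>, of "\<lambda>x. of_bool (h x = r)" "\<lambda>y. of_bool (g y = r)" d] \<alpha>
    by (auto simp: norms)
  have w_powr: "w r * w r powr t = w r powr (1 + t)" for r t
    using w[of r] by (cases "w r = 0") (simp_all add: powr_add)
  \<comment> \<open>Jensen with weights and values both \<open>w\<close>; \<open>1 + k\<close> is
    exactly the hypercontractive exponent.\<close>
  have "\<phi> 0 powr k \<le> (\<Sum>r\<in>R. w r * w r powr k)"
    unfolding \<phi>0 by (rule powr_Jensen_subprob[OF R(1) w w sum_w k])
  also have "\<dots> = (\<Sum>r\<in>R. w r powr (2 / (1 - \<bar>\<alpha>\<bar>)))"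
  proof -
    have "1 + k = 2 / (1 - \<bar>\<alpha>\<bar>)" using \<alpha> by (simp add: k_def field_simps)
    thus ?thesis by (simp add: w_powr)
  qed
  also have "\<dots> \<le> \<phi> \<alpha>"
    unfolding \<phi>_def prob_eq_sum_cube_form[OF R(1,2)] by (intro sum_mono hyper)
  finally show "\<phi> 0 powr k \<le> \<phi> \<alpha>" .
  have "\<phi> \<alpha> \<le> (\<Sum>r\<in>R. w r powr (2 / (1 + \<bar>\<alpha>\<bar>)))"
    unfolding \<phi>_def prob_eq_sum_cube_form[OF R(1,2)] by (intro sum_mono hyper)
  also have "\<dots> = (\<Sum>r\<in>R. w r * w r powr (1 / k))"
  proof -
    have "1 + 1 / k = 2 / (1 + \<bar>\<alpha>\<bar>)" using \<alpha> by (simp add: k_def field_simps)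
    thus ?thesis by (simp add: w_powr)
  qed
  finally have "\<phi> \<alpha> powr k \<le> (\<Sum>r\<in>R. w r * w r powr (1 / k)) powr k"
    using k by (intro powr_mono2) (auto simp: \<phi>_def)
  \<comment> \<open>Jensen with values \<open>w r powr (1 / k)\<close>, whose \<open>k\<close>-th
    powers restore \<open>w r\<close>.\<close>
  also have "\<dots> \<le> (\<Sum>r\<in>R. w r * (w r powr (1 / k)) powr k)"
    by (rule powr_Jensen_subprob[OF R(1) w _ sum_w k]) simp
  also have "\<dots> = \<phi> 0" unfolding \<phi>0 using k w by (simp add: powr_powr)
  finally show "\<phi> \<alpha> powr k \<le> \<phi> 0" .
qed

section \<open>Averaging over the pair of functions\<close>

lemma collision_prob_eq_sum:
  fixes \<A> :: "(((nat \<Rightarrow> int) \<Rightarrow> 'r) \<times> ((nat \<Rightarrow> int) \<Rightarrow> 'r)) pmf"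
  assumes "finite (set_pmf \<A>)"
  shows "collision_prob d \<A> \<beta> = (\<Sum>c\<in>set_pmf \<A>. pmf \<A> c *
    measure_pmf.prob (correlated_pair d \<beta>) {(x, y). fst c x = snd c y})"
proof -
  define F :: "(((nat \<Rightarrow> int) \<Rightarrow> 'r) \<times> ((nat \<Rightarrow> int) \<Rightarrow> 'r)) \<times> ((nat \<Rightarrow> int) \<times> (nat \<Rightarrow> int)) \<Rightarrow> real"
    where "F = indicator {((h, g), (x, y)). h x = g y}"
  have F: "(\<lambda>z. F (c, z)) = indicator {(x, y). fst c x = snd c y}" for c
    by (auto simp: F_def indicator_def fun_eq_iff)
  have "collision_prob d \<A> \<beta>
      = measure_pmf.expectation (\<A> \<bind> (\<lambda>c. map_pmf (Pair c) (correlated_pair d \<beta>))) F"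
    by (simp add: F_def collision_prob_def pair_pmf_def map_pmf_def)
  also have "\<dots> = (\<Sum>c\<in>set_pmf \<A>. pmf \<A> c *
      measure_pmf.expectation (correlated_pair d \<beta>) (\<lambda>z. F (c, z)))"
    using assms by (subst pmf_expectation_bind[of "set_pmf \<A>"])
      (simp_all add: finite_set_pmf_correlated_pair)
  finally show ?thesis by (simp add: F)
qed

theorem theorem6p1:
  fixes d :: nat and R :: "'r set"
    and \<A> :: "(((nat \<Rightarrow> int) \<Rightarrow> 'r) \<times> ((nat \<Rightarrow> int) \<Rightarrow> 'r)) pmf"
    and \<alpha> :: real
  assumes "finite R"
    and "set_pmf \<A> \<subseteq> (cube d \<rightarrow>\<^sub>E R) \<times> (cube d \<rightarrow>\<^sub>E R)"
    and "-1 < \<alpha>" and "\<alpha> < 1"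
  shows "collision_prob d \<A> 0 powr ((1 + \<bar>\<alpha>\<bar>) / (1 - \<bar>\<alpha>\<bar>)) \<le> collision_prob d \<A> \<alpha> \<and>
         collision_prob d \<A> \<alpha> \<le> collision_prob d \<A> 0 powr ((1 - \<bar>\<alpha>\<bar>) / (1 + \<bar>\<alpha>\<bar>))"
proof -
  define k where "k = (1 + \<bar>\<alpha>\<bar>) / (1 - \<bar>\<alpha>\<bar>)"
  define \<phi> where "\<phi> \<beta> c = measure_pmf.prob (correlated_pair d \<beta>) {(x, y). fst c x = snd c y}"
    for \<beta> and c :: "((nat \<Rightarrow> int) \<Rightarrow> 'r) \<times> ((nat \<Rightarrow> int) \<Rightarrow> 'r)"
  have \<alpha>: "\<bar>\<alpha>\<bar> < 1" using assms by auto
  have k: "1 \<le> k" using \<alpha> by (simp add: k_def)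
  \<comment> \<open>There are only finitely many extensional functions from the finite cube to
    \<open>R\<close>.\<close>
  have fin: "finite (set_pmf \<A>)"
    using assms(1,2) by (rule_tac finite_subset[OF assms(2)]) (simp add: finite_PiE finite_cube)
  note collision = collision_prob_eq_sum[OF fin, of d, folded \<phi>_def]
  have maps: "fst c \<in> cube d \<rightarrow> R" "snd c \<in> cube d \<rightarrow> R" if "c \<in> set_pmf \<A>" for c
    using subsetD[OF assms(2) that] by (auto simp: PiE_def mem_Times_iff)
  have pointwise: "\<phi> 0 c powr k \<le> \<phi> \<alpha> c" "\<phi> \<alpha> c powr k \<le> \<phi> 0 c" if "c \<in> set_pmf \<A>" for c
    using collision_fixed_pair[OF assms(1) maps[OF that] \<alpha>] by (simp_all add: \<phi>_def k_def)
  \<comment> \<open>Jensen with the probabilities of \<A> as weights, used once in each direction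
    between 0 and \<alpha>.\<close>
  have average: "collision_prob d \<A> \<beta> powr k \<le> collision_prob d \<A> \<gamma>"
    if "\<And>c. c \<in> set_pmf \<A> \<Longrightarrow> \<phi> \<beta> c powr k \<le> \<phi> \<gamma> c" for \<beta> \<gamma>
  proof -
    have "collision_prob d \<A> \<beta> powr k \<le> (\<Sum>c\<in>set_pmf \<A>. pmf \<A> c * \<phi> \<beta> c powr k)"
      unfolding collision using fin k
      by (intro powr_Jensen_subprob) (auto simp: \<phi>_def sum_pmf_eq_1)
    also have "\<dots> \<le> collision_prob d \<A> \<gamma>"
      unfolding collision by (intro sum_mono mult_left_mono that) auto
    finally show ?thesis .
  qed
  \<comment> \<open>The root is taken only after averaging, when it no longer conflicts with the
    direction of Jensen's inequality.\<close>
  have "(collision_prob d \<A> \<alpha> powr k) powr (1 / k) \<le> collision_prob d \<A> 0 powr (1 / k)"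
    using k by (intro powr_mono2 average pointwise) auto
  hence "collision_prob d \<A> \<alpha> \<le> collision_prob d \<A> 0 powr (1 / k)"
    using k by (simp add: powr_powr collision_prob_def)
  moreover have "1 / k = (1 - \<bar>\<alpha>\<bar>) / (1 + \<bar>\<alpha>\<bar>)" by (simp add: k_def)
  ultimately show ?thesis
    using average[OF pointwise(1)] by (simp add: k_def)
qed

end
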